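(* If a finite simple graph $G$ is cobipartite, then $Z_+(G)=Z(G)$.
   Context: A graph is cobipartite if its vertex set can be partitioned into two cliques. $Z(G)$ is the zero forcing number: the smallest size of an initially filled set from which repeatedly applying the rule "a filled vertex $v$ whose only unfilled neighbor is $u$ forces $u$ to become filled" fills all vertices. Positive semidefinite zero forcing rule: consider the subgraph obtained by deleting all filled vertices; if a filled vertex $v$ has exactly one neighbor $u$ in some connected component of that subgraph, then $v$ may force $u$ to become filled. $Z_+(G)$ is the smallest size of an initially filled set from which repeated application of this rule fills all vertices. *)

theory Defs
  imports "Graph_Theory.Digraph_Component"
begin

text \<open>
  A finite simple graph is an instance of the locale \<open>graph\<close>: a finite symmetric digraph without
  loops and without parallel arcs, so that \<open>u \<rightarrow>\<^bsub>G\<^esub> v\<close> is the adjacency relation. The graph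
  without vertices is not excluded.
\<close>

definition clique :: "('a, 'b) pre_digraph \<Rightarrow> 'a set \<Rightarrow> bool" where
  "clique G K \<longleftrightarrow> K \<subseteq> verts G \<and> (\<forall>u\<in>K. \<forall>v\<in>K. u \<noteq> v \<longrightarrow> u \<rightarrow>\<^bsub>G\<^esub> v)"

text \<open>One of the two cliques may be empty.\<close>

definition cobipartite :: "('a, 'b) pre_digraph \<Rightarrow> bool" where
  "cobipartite G \<longleftrightarrow>
     (\<exists>K L. K \<union> L = verts G \<and> K \<inter> L = {} \<and> clique G K \<and> clique G L)"

definition zf_forces :: "('a, 'b) pre_digraph \<Rightarrow> 'a set \<Rightarrow> 'a \<Rightarrow> 'a \<Rightarrow> bool" where
  "zf_forces G B v u \<longleftrightarrow> v \<in> B \<and> {w \<in> verts G - B. v \<rightarrow>\<^bsub>G\<^esub> w} = {u}"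

text \<open>
  As \<open>G\<close> is symmetric, the strongly connected components of \<open>G \<restriction> (verts G - B)\<close> are the
  connected components of the graph obtained from \<open>G\<close> by deleting \<open>B\<close>; \<open>sccs_verts\<close> is the
  set of their vertex sets.
\<close>

definition psd_forces :: "('a, 'b) pre_digraph \<Rightarrow> 'a set \<Rightarrow> 'a \<Rightarrow> 'a \<Rightarrow> bool" where
  "psd_forces G B v u \<longleftrightarrow>
     v \<in> B \<and> (\<exists>C \<in> pre_digraph.sccs_verts (G \<restriction> (verts G - B)). {w \<in> C. v \<rightarrow>\<^bsub>G\<^esub> w} = {u})"

definition zf_step :: "('a, 'b) pre_digraph \<Rightarrow> 'a set \<Rightarrow> 'a set \<Rightarrow> bool" where
  "zf_step G B B' \<longleftrightarrow> (\<exists>v u. zf_forces G B v u \<and> B' = insert u B)"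

definition psd_step :: "('a, 'b) pre_digraph \<Rightarrow> 'a set \<Rightarrow> 'a set \<Rightarrow> bool" where
  "psd_step G B B' \<longleftrightarrow> (\<exists>v u. psd_forces G B v u \<and> B' = insert u B)"

definition zero_forcing_set :: "('a, 'b) pre_digraph \<Rightarrow> 'a set \<Rightarrow> bool" where
  "zero_forcing_set G B \<longleftrightarrow> B \<subseteq> verts G \<and> (zf_step G)\<^sup>*\<^sup>* B (verts G)"

definition psd_forcing_set :: "('a, 'b) pre_digraph \<Rightarrow> 'a set \<Rightarrow> bool" where
  "psd_forcing_set G B \<longleftrightarrow> B \<subseteq> verts G \<and> (psd_step G)\<^sup>*\<^sup>* B (verts G)"

definition zero_forcing_number :: "('a, 'b) pre_digraph \<Rightarrow> nat" where
  "zero_forcing_number G = (LEAST k. \<exists>B. zero_forcing_set G B \<and> card B = k)"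

definition psd_forcing_number :: "('a, 'b) pre_digraph \<Rightarrow> nat" where
  "psd_forcing_number G = (LEAST k. \<exists>B. psd_forcing_set G B \<and> card B = k)"

text \<open>The minima above are over nonempty sets:\<close>

lemma zero_forcing_set_verts: "zero_forcing_set G (verts G)"
  by (simp add: zero_forcing_set_def)

lemma psd_forcing_set_verts: "psd_forcing_set G (verts G)"
  by (simp add: psd_forcing_set_def)

end

theory Submission
  imports Defs
begin

text \<open>
  Write \<open>K\<close>, \<open>L\<close> for the two cliques, and let \<open>B\<close> be a positive semidefinite forcing set. If
  \<open>K - B\<close> or \<open>L - B\<close> is empty, the unfilled graph is connected and stays so, hence all forces are
  standard ones. If there is an unfilled edge between \<open>K\<close> and \<open>L\<close>, the first force is a standard
  one, and its source being adjacent to its whole clique, it exhausts the unfilled vertices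
  of that clique. In the remaining case \<open>K - B\<close> and \<open>L - B\<close> are separated, so
  vertices \<open>V\<close> of \<open>L \<inter> B\<close> force those of \<open>K - B\<close> one by one, and vertices of
  \<open>K \<inter> B\<close> force those of \<open>L - B\<close>, up to the last vertex of either clique. Reversing the forces
  of the first kind, one obtains a standard forcing set of the same size: fill
  everything except \<open>V\<close> and \<open>L - B\<close>; then \<open>K - B\<close> forces \<open>V\<close> in the reverse order, and
  afterwards \<open>L - B\<close> is forced from \<open>K\<close> as before. A last vertex without neighbours in the other
  clique is treated separately: in \<open>K\<close> it forces one extra vertex of \<open>K\<close> at the very beginning,
  and in \<open>L\<close> it is forced from \<open>L\<close> at the very end.
\<close>

section \<open>Standard and positive semidefinite forces\<close>

lemma zf_step_insert:
  assumes "v \<in> B" "{w \<in> verts G - B. v \<rightarrow>\<^bsub>G\<^esub> w} = {u}"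
  shows "zf_step G B (insert u B)"
  using assms unfolding zf_step_def zf_forces_def by blast

context graph
begin

lemma adj_sym: "u \<rightarrow>\<^bsub>G\<^esub> v \<Longrightarrow> v \<rightarrow>\<^bsub>G\<^esub> u"
  by (rule graph_symmetric)

lemma sym_digraph_induce: "S \<subseteq> verts G \<Longrightarrow> sym_digraph (G \<restriction> S)"
  by (intro induced_graph_imp_graph induced_induce)

lemma adj_induce:
  assumes "u \<in> S" "v \<in> S" "u \<rightarrow>\<^bsub>G\<^esub> v"
  shows "u \<rightarrow>\<^bsub>G \<restriction> S\<^esub> v"
  using assms by (auto simp: arcs_ends_conv)

lemma reachable_induce_adj:
  assumes "S \<subseteq> verts G" "u \<in> S" "v \<in> S" "u \<rightarrow>\<^bsub>G\<^esub> v"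
  shows "u \<rightarrow>\<^sup>*\<^bsub>G \<restriction> S\<^esub> v"
proof -
  interpret H: sym_digraph "G \<restriction> S" using assms(1) by (rule sym_digraph_induce)
  show ?thesis using adj_induce[OF assms(2-4)] by (rule H.reachable_adjI)
qed

lemma psd_forces_props:
  assumes "psd_forces G B v u"
  shows "v \<in> B" "u \<in> verts G" "u \<notin> B" "v \<rightarrow>\<^bsub>G\<^esub> u"
proof -
  obtain C where C: "v \<in> B" "C \<in> pre_digraph.sccs_verts (G \<restriction> (verts G - B))"
    "{w \<in> C. v \<rightarrow>\<^bsub>G\<^esub> w} = {u}"
    using assms unfolding psd_forces_def by blast
  interpret H: sym_digraph "G \<restriction> (verts G - B)" by (rule sym_digraph_induce) auto
  have "C \<subseteq> verts G - B" using H.sccs_verts_subsets[OF C(2)] by simp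
  with C show "v \<in> B" "u \<in> verts G" "u \<notin> B" "v \<rightarrow>\<^bsub>G\<^esub> u" by auto
qed

text \<open>Reachability is mutual in a symmetric digraph, so \<open>w\<close> lies in the component
  in which \<open>v\<close> has \<open>u\<close> as its sole neighbour.\<close>

lemma psd_forces_reachable:
  assumes "psd_forces G B v u" "u \<rightarrow>\<^sup>*\<^bsub>G \<restriction> (verts G - B)\<^esub> w" "w \<noteq> u"
  shows "\<not> v \<rightarrow>\<^bsub>G\<^esub> w"
proof -
  obtain C where C: "C \<in> pre_digraph.sccs_verts (G \<restriction> (verts G - B))"
    "{w \<in> C. v \<rightarrow>\<^bsub>G\<^esub> w} = {u}"
    using assms unfolding psd_forces_def by blast
  interpret H: sym_digraph "G \<restriction> (verts G - B)" by (rule sym_digraph_induce) auto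
  have "u \<in> C" using C(2) by auto
  then have "w \<in> C"
    using C(1) assms(2) H.symmetric_reachable'[OF assms(2)]
    unfolding H.in_sccs_verts_conv_reachable by blast
  with C(2) assms(3) show ?thesis by auto
qed

lemma psd_forces_adj:
  assumes "psd_forces G B v u" "w \<in> verts G - B" "u \<rightarrow>\<^bsub>G\<^esub> w" "w \<noteq> u"
  shows "\<not> v \<rightarrow>\<^bsub>G\<^esub> w"
  using psd_forces_props[OF assms(1)] assms
  by (intro psd_forces_reachable[OF assms(1)] reachable_induce_adj) auto

lemma psd_forces_imp_zf_forces:
  assumes "psd_forces G B v u"
    and "\<And>w. w \<in> verts G - B \<Longrightarrow> w \<noteq> u \<Longrightarrow> u \<rightarrow>\<^sup>*\<^bsub>G \<restriction> (verts G - B)\<^esub> w"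
  shows "zf_forces G B v u"
  using psd_forces_props[OF assms(1)] psd_forces_reachable[OF assms(1)] assms(2)
  unfolding zf_forces_def by blast

text \<open>Passing to the component of \<open>u\<close> keeps \<open>u\<close> and adds no
  neighbours of \<open>v\<close>. This yields the inequality between the two numbers that holds in
  every graph.\<close>

lemma zf_forces_imp_psd_forces:
  assumes "zf_forces G B v u"
  shows "psd_forces G B v u"
proof -
  interpret H: sym_digraph "G \<restriction> (verts G - B)" by (rule sym_digraph_induce) auto
  have u: "u \<in> verts G - B" and v: "v \<in> B" "{w \<in> verts G - B. v \<rightarrow>\<^bsub>G\<^esub> w} = {u}"
    using assms unfolding zf_forces_def by auto
  let ?C = "H.scc_of u"
  have C: "?C \<in> H.sccs_verts" using u by (intro H.scc_of_in_sccs_verts) simp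
  then have "?C \<subseteq> verts G - B" using H.sccs_verts_subsets[OF C] by simp
  moreover have "u \<in> ?C" using u by (intro H.in_scc_of_self) simp
  ultimately have "{w \<in> ?C. v \<rightarrow>\<^bsub>G\<^esub> w} = {u}" using v(2) by blast
  with C v(1) show ?thesis unfolding psd_forces_def by blast
qed

lemma zero_forcing_set_imp_psd_forcing_set:
  assumes "zero_forcing_set G B"
  shows "psd_forcing_set G B"
proof -
  have "zf_step G \<le> psd_step G"
    using zf_forces_imp_psd_forces unfolding zf_step_def psd_step_def by blast
  then show ?thesis
    using assms rtranclp_mono unfolding zero_forcing_set_def psd_forcing_set_def by blast
qed

end

section \<open>Triangular patterns as chains of forces\<close>

text \<open>
  With suitable enumerations of \<open>X\<close> and \<open>V\<close> the biadjacency matrix between them is triangular with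
  nonzero diagonal. Read backwards, this is a chain of forces from \<open>V\<close> to \<open>X\<close>;
  read forwards, one from \<open>X\<close> to \<open>V\<close>.
\<close>

inductive triangular :: "('a, 'b) pre_digraph \<Rightarrow> 'a set \<Rightarrow> 'a set \<Rightarrow> bool" for G where
  empty: "triangular G {} {}"
| insert: "triangular G X V \<Longrightarrow> x \<notin> X \<Longrightarrow> v \<notin> V \<Longrightarrow> x \<rightarrow>\<^bsub>G\<^esub> v \<Longrightarrow> (\<And>y. y \<in> X \<Longrightarrow> \<not> y \<rightarrow>\<^bsub>G\<^esub> v)
    \<Longrightarrow> triangular G (insert x X) (insert v V)"

lemma triangular_finite_card: "triangular G X V \<Longrightarrow> finite X \<and> finite V \<and> card X = card V"
  by (induction rule: triangular.induct) auto

lemma triangular_neighbour: "triangular G X V \<Longrightarrow> v \<in> V \<Longrightarrow> \<exists>x\<in>X. x \<rightarrow>\<^bsub>G\<^esub> v"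
  by (induction rule: triangular.induct) auto

lemma triangular_forces_right:
  assumes "triangular G X V" "X \<subseteq> B" "V \<subseteq> verts G - B"
    and "\<And>x w. x \<in> X \<Longrightarrow> w \<in> verts G - B \<Longrightarrow> x \<rightarrow>\<^bsub>G\<^esub> w \<Longrightarrow> w \<in> V"
  shows "(zf_step G)\<^sup>*\<^sup>* B (B \<union> V)"
  using assms
proof (induction rule: triangular.induct)
  case (insert X V x v)
  have "(zf_step G)\<^sup>*\<^sup>* B (B \<union> V)"
  proof (rule insert.IH)
    \<comment> \<open>Earlier rows do not see \<open>v\<close>, so their unfilled neighbours stay
      within \<open>V\<close>.\<close>
    show "w \<in> V" if "y \<in> X" "w \<in> verts G - B" "y \<rightarrow>\<^bsub>G\<^esub> w" for y w
      using insert.prems(3)[of y w] insert.hyps(5)[of y] that by blast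
  qed (use insert.prems in auto)
  moreover have "zf_step G (B \<union> V) (insert v (B \<union> V))"
    using insert.prems insert.hyps by (intro zf_step_insert[of x]) auto
  ultimately show ?case by auto
qed auto

text \<open>The pair inserted last acts first: \<open>v\<close> misses all earlier rows, so
  \<open>x\<close> is its only unfilled neighbour. \<open>B\<close> is generalized because
  \<open>x\<close> is filled before the induction hypothesis applies.\<close>

lemma (in graph) triangular_forces_left:
  assumes "triangular G X V" "V \<subseteq> B" "X \<subseteq> verts G - B"
    and "\<And>v w. v \<in> V \<Longrightarrow> w \<in> verts G - B \<Longrightarrow> v \<rightarrow>\<^bsub>G\<^esub> w \<Longrightarrow> w \<in> X"
  shows "(zf_step G)\<^sup>*\<^sup>* B (B \<union> X)"
  using assms
proof (induction arbitrary: B rule: triangular.induct)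
  case (insert X V x v)
  have nadj: "\<not> v \<rightarrow>\<^bsub>G\<^esub> y" if "y \<in> X" for y
    using insert.hyps(5)[OF that] adj_sym[of v y] by blast
  have "zf_step G B (insert x B)"
    using insert.prems(1,2) insert.prems(3)[of v] nadj adj_sym[OF insert.hyps(4)]
    by (intro zf_step_insert[of v]) auto
  moreover have "(zf_step G)\<^sup>*\<^sup>* (insert x B) (insert x B \<union> X)"
  proof (rule insert.IH)
    show "w \<in> X" if "v' \<in> V" "w \<in> verts G - insert x B" "v' \<rightarrow>\<^bsub>G\<^esub> w" for v' w
      using insert.prems(3)[of v' w] that by auto
  qed (use insert.prems insert.hyps in auto)
  ultimately show ?case by (simp add: converse_rtranclp_into_rtranclp)
qed auto

section \<open>Two cliques: the separated chains\<close>

locale two_cliques = graph G for G :: "('a, 'b) pre_digraph" +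
  fixes K L :: "'a set"
  assumes verts: "K \<union> L = verts G" and disjoint: "K \<inter> L = {}"
    and cliques: "clique G K" "clique G L"
begin

text \<open>Makes every one-sided result about \<open>K\<close> available for
  \<open>L\<close>.\<close>

lemma swap: "two_cliques G L K"
  using verts disjoint cliques by unfold_locales auto

lemma K_adj: "u \<in> K \<Longrightarrow> v \<in> K \<Longrightarrow> u \<noteq> v \<Longrightarrow> u \<rightarrow>\<^bsub>G\<^esub> v"
  using cliques unfolding clique_def by blast

lemma L_adj: "u \<in> L \<Longrightarrow> v \<in> L \<Longrightarrow> u \<noteq> v \<Longrightarrow> u \<rightarrow>\<^bsub>G\<^esub> v"
  using cliques unfolding clique_def by blast

text \<open>
  What the forces inside \<open>K - B\<close> leave behind when \<open>K - B\<close> is separated from \<open>L - B\<close>. The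
  exceptional vertex \<open>x\<close> is the last one to be forced, its source \<open>q\<close> being in \<open>K\<close>.
\<close>

definition almost_triangular :: "'a set \<Rightarrow> 'a set \<Rightarrow> 'a set \<Rightarrow> bool" where
  "almost_triangular B X V \<longleftrightarrow> triangular G X V \<and> V \<subseteq> L \<inter> B \<and>
     (X = K - B \<or> (\<exists>x q. x \<notin> X \<and> insert x X = K - B \<and> (\<forall>l\<in>L. \<not> x \<rightarrow>\<^bsub>G\<^esub> l) \<and> q \<in> K \<and> q \<noteq> x))"

text \<open>Induction from the last force back to the first; separation passes on to larger filled
  sets. A force from \<open>L\<close> into \<open>K\<close> adds a pair to the pattern, a force into
  \<open>L\<close> adds nothing.\<close>

lemma psd_steps_almost_triangular:
  assumes "(psd_step G)\<^sup>*\<^sup>* B (verts G)"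
    and "\<And>k l. k \<in> K - B \<Longrightarrow> l \<in> L - B \<Longrightarrow> \<not> k \<rightarrow>\<^bsub>G\<^esub> l"
  shows "\<exists>X V. almost_triangular B X V"
  using assms
proof (induction rule: converse_rtranclp_induct)
  case base
  have "K - verts G = {}" using verts by auto
  then show ?case unfolding almost_triangular_def using triangular.empty by blast
next
  case (step B B')
  note sep = step.prems
  obtain p u where f: "psd_forces G B p u" and B': "B' = insert u B"
    using step.hyps(1) unfolding psd_step_def by blast
  note fp = psd_forces_props[OF f]
  have "\<exists>X V. almost_triangular B' X V"
    by (rule step.IH) (use sep B' in auto)
  then obtain X V where t: "triangular G X V" and V: "V \<subseteq> L \<inter> insert u B"
    and X: "X = K - insert u B \<or> (\<exists>x q. x \<notin> X \<and> insert x X = K - insert u B \<and>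
      (\<forall>l\<in>L. \<not> x \<rightarrow>\<^bsub>G\<^esub> l) \<and> q \<in> K \<and> q \<noteq> x)"
    unfolding almost_triangular_def B' by blast
  have XK: "X \<subseteq> K - insert u B" using X by auto
  have uKL: "u \<in> K \<or> u \<in> L" using fp verts by auto
  show ?case
  proof (cases "u \<in> K")
    case False
    then have "u \<in> L" using uKL by auto
    \<comment> \<open>Otherwise \<open>u\<close> would have a neighbour in \<open>X\<close>, an
      unfilled edge between the cliques.\<close>
    then have "u \<notin> V" using triangular_neighbour[OF t, of u] XK sep fp(3) by blast
    moreover have "K - insert u B = K - B" using False by auto
    ultimately have "almost_triangular B X V"
      unfolding almost_triangular_def using t V X by auto
    then show ?thesis by blast
  next
    case uK: True
    have uL: "u \<notin> L" using uK disjoint by auto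
    have VB: "V \<subseteq> L \<inter> B" using V uL by auto
    have Kins: "K - B = insert u (K - insert u B)" using uK fp(3) by auto
    \<comment> \<open>The rest of \<open>K - B\<close> is adjacent to \<open>u\<close>, hence in its
      component and missed by \<open>p\<close>.\<close>
    have nadj: "\<not> p \<rightarrow>\<^bsub>G\<^esub> w" if "w \<in> K - insert u B" for w
      using that verts K_adj[OF uK, of w] by (intro psd_forces_adj[OF f]) auto
    show ?thesis
    proof (cases "p \<in> L")
      case True
      have nadj': "\<not> w \<rightarrow>\<^bsub>G\<^esub> p" if "w \<in> X" for w
        using nadj[of w] adj_sym[of w p] that XK by blast
      have "p \<notin> V" using triangular_neighbour[OF t, of p] nadj' by blast
      then have t': "triangular G (insert u X) (insert p V)"
        using XK nadj' adj_sym[OF fp(4)] by (intro triangular.insert t) auto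
      have "insert u X = K - B \<or> (\<exists>x q. x \<notin> insert u X \<and> insert x (insert u X) = K - B \<and>
        (\<forall>l\<in>L. \<not> x \<rightarrow>\<^bsub>G\<^esub> l) \<and> q \<in> K \<and> q \<noteq> x)"
        using X
      proof (elim disjE exE conjE)
        fix x q
        assume x: "x \<notin> X" "insert x X = K - insert u B" "\<forall>l\<in>L. \<not> x \<rightarrow>\<^bsub>G\<^esub> l" "q \<in> K" "q \<noteq> x"
        have "x \<noteq> u" using x(2) by auto
        moreover have "insert x (insert u X) = K - B" using x(2) Kins by auto
        ultimately show ?thesis using x by blast
      qed (use Kins in auto)
      then have "almost_triangular B (insert u X) (insert p V)"
        unfolding almost_triangular_def using t' VB True fp(1) by auto
      then show ?thesis by blast
    next
      case False
      have pK: "p \<in> K" using False verts adj_in_verts(1)[OF fp(4)] by auto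
      \<comment> \<open>A source in \<open>K\<close> sees all of \<open>K\<close>, so such a force
        occurs only when \<open>u\<close> is the last unfilled vertex of \<open>K\<close>.\<close>
      have "K - insert u B = {}" using nadj K_adj[OF pK] fp(1) by blast
      then have KB: "K - B = {u}" using uK fp(3) by blast
      have pu: "p \<noteq> u" using fp by auto
      show ?thesis
      \<comment> \<open>A neighbour of \<open>u\<close> in \<open>L\<close> is filled by separation
        and replaces \<open>p\<close> as partner of \<open>u\<close>. Without one, \<open>u\<close>
        becomes the exceptional vertex, with \<open>q\<close> being \<open>p\<close>.\<close>
      proof (cases "\<exists>l\<in>L. u \<rightarrow>\<^bsub>G\<^esub> l")
        case True
        then obtain l where l: "l \<in> L" "u \<rightarrow>\<^bsub>G\<^esub> l" by blast
        have "l \<in> B" using sep[of u l] l KB by blast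
        moreover have "triangular G {u} {l}"
          using triangular.insert[OF triangular.empty, of u l] l by auto
        ultimately have "almost_triangular B {u} {l}"
          unfolding almost_triangular_def using KB l by auto
        then show ?thesis by blast
      next
        case False
        then have "almost_triangular B {} {}"
          unfolding almost_triangular_def using KB pK pu triangular.empty by blast
        then show ?thesis by blast
      qed
    qed
  qed
qed

section \<open>Connected unfilled graphs\<close>

lemma psd_steps_one_clique:
  assumes "(psd_step G)\<^sup>*\<^sup>* B (verts G)" "K - B = {}"
  shows "(zf_step G)\<^sup>*\<^sup>* B (verts G)"
  using assms
proof (induction rule: converse_rtranclp_induct)
  case (step B B')
  obtain p u where f: "psd_forces G B p u" and B': "B' = insert u B"
    using step.hyps(1) unfolding psd_step_def by blast
  have UL: "verts G - B \<subseteq> L" using step.prems verts by auto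
  have "zf_forces G B p u"
  proof (rule psd_forces_imp_zf_forces[OF f])
    fix w assume "w \<in> verts G - B" "w \<noteq> u"
    then show "u \<rightarrow>\<^sup>*\<^bsub>G \<restriction> (verts G - B)\<^esub> w"
      using UL psd_forces_props[OF f] by (intro reachable_induce_adj L_adj) auto
  qed
  then have "zf_step G B B'" unfolding zf_step_def B' by blast
  moreover have "K - B' = {}" using step.prems B' by auto
  ultimately show ?case using step.IH by (meson converse_rtranclp_into_rtranclp)
qed auto

lemma unfilled_edge_reachable:
  assumes "k \<in> K - B" "l \<in> L - B" "k \<rightarrow>\<^bsub>G\<^esub> l" "w \<in> verts G - B"
  shows "k \<rightarrow>\<^sup>*\<^bsub>G \<restriction> (verts G - B)\<^esub> w"
proof -
  interpret H: sym_digraph "G \<restriction> (verts G - B)" by (rule sym_digraph_induce) auto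
  have kl: "k \<rightarrow>\<^sup>*\<^bsub>G \<restriction> (verts G - B)\<^esub> l"
    using assms verts by (intro reachable_induce_adj) auto
  have refl: "w \<rightarrow>\<^sup>*\<^bsub>G \<restriction> (verts G - B)\<^esub> w" using assms(4) by (intro H.reachable_refl) simp
  show ?thesis
  proof (cases "w \<in> K")
    case True
    show ?thesis
    proof (cases "w = k")
      case False
      then show ?thesis using True assms verts by (intro reachable_induce_adj K_adj) auto
    qed (use refl in simp)
  next
    case False
    then have wL: "w \<in> L" using assms(4) verts by auto
    have "l \<rightarrow>\<^sup>*\<^bsub>G \<restriction> (verts G - B)\<^esub> w"
    proof (cases "w = l")
      case False
      then show ?thesis using wL assms verts by (intro reachable_induce_adj L_adj) auto
    qed (use refl in simp)
    with kl show ?thesis by (rule H.reachable_trans)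
  qed
qed

lemma psd_steps_unfilled_edge:
  assumes "(psd_step G)\<^sup>*\<^sup>* B (verts G)" "k \<in> K - B" "l \<in> L - B" "k \<rightarrow>\<^bsub>G\<^esub> l"
  shows "(zf_step G)\<^sup>*\<^sup>* B (verts G)"
  using assms(1)
proof (cases rule: converse_rtranclpE)
  case (step B')
  interpret H: sym_digraph "G \<restriction> (verts G - B)" by (rule sym_digraph_induce) auto
  interpret S: two_cliques G L K by (rule swap)
  obtain p u where f: "psd_forces G B p u" and B': "B' = insert u B"
    using step(1) unfolding psd_step_def by blast
  note fp = psd_forces_props[OF f]
  have "zf_forces G B p u"
  proof (rule psd_forces_imp_zf_forces[OF f])
    fix w assume "w \<in> verts G - B"
    then have "k \<rightarrow>\<^sup>*\<^bsub>G \<restriction> (verts G - B)\<^esub> w" using assms by (intro unfilled_edge_reachable) auto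
    moreover have "k \<rightarrow>\<^sup>*\<^bsub>G \<restriction> (verts G - B)\<^esub> u"
      using assms fp by (intro unfilled_edge_reachable) auto
    ultimately show "u \<rightarrow>\<^sup>*\<^bsub>G \<restriction> (verts G - B)\<^esub> w"
      using H.symmetric_reachable' H.reachable_trans by blast
  qed
  then have zf: "zf_step G B B'" and only: "\<And>w. w \<in> verts G - B' \<Longrightarrow> \<not> p \<rightarrow>\<^bsub>G\<^esub> w"
    unfolding zf_step_def zf_forces_def B' by blast+
  have pB: "p \<in> B'" using fp B' by auto
  have "K - B' = {} \<or> L - B' = {}"
  proof (cases "p \<in> K")
    case True
    then have "K - B' = {}" using only K_adj[OF True] pB verts by blast
    then show ?thesis ..
  next
    case False
    then have pL: "p \<in> L" using verts adj_in_verts(1)[OF fp(4)] by auto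
    then have "L - B' = {}" using only L_adj[OF pL] pB verts by blast
    then show ?thesis ..
  qed
  then have "(zf_step G)\<^sup>*\<^sup>* B' (verts G)"
    using psd_steps_one_clique[OF step(2)] S.psd_steps_one_clique[OF step(2)] by blast
  with zf show ?thesis by (rule converse_rtranclp_into_rtranclp)
qed auto

section \<open>Reversing the chain into one clique\<close>

lemma separated_zero_forcing_set:
  assumes B: "B \<subseteq> verts G"
    and sep: "\<And>k l. k \<in> K - B \<Longrightarrow> l \<in> L - B \<Longrightarrow> \<not> k \<rightarrow>\<^bsub>G\<^esub> l"
    and XV: "almost_triangular B X V"
    and YW: "two_cliques.almost_triangular G L K B Y W"
  shows "\<exists>B'. zero_forcing_set G B' \<and> card B' = card B"
proof -
  interpret S: two_cliques G L K by (rule swap)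
  have tX: "triangular G X V" and V: "V \<subseteq> L \<inter> B"
    and X: "X = K - B \<or> (\<exists>x q. x \<notin> X \<and> insert x X = K - B \<and> (\<forall>l\<in>L. \<not> x \<rightarrow>\<^bsub>G\<^esub> l) \<and> q \<in> K \<and> q \<noteq> x)"
    using XV unfolding almost_triangular_def by auto
  have tY: "triangular G Y W" and W: "W \<subseteq> K \<inter> B"
    and Y: "Y = L - B \<or> (\<exists>y r. y \<notin> Y \<and> insert y Y = L - B \<and> (\<forall>k\<in>K. \<not> y \<rightarrow>\<^bsub>G\<^esub> k) \<and> r \<in> L \<and> r \<noteq> y)"
    using YW unfolding S.almost_triangular_def by auto
  have fin: "finite K" "finite L" "finite B"
    using verts finite_verts finite_subset[OF B] by (metis finite_Un)+
  have XK: "X \<subseteq> K - B" using X by auto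
  have YL: "Y \<subseteq> L - B" using Y by auto
  \<comment> \<open>\<open>D\<close> is the set left unfilled at the start: \<open>V\<close> takes
    the place of \<open>X\<close>, at equal cardinality.\<close>
  define D where "D = V \<union> (L - B)"
  have DL: "D \<subseteq> L" using V unfolding D_def by auto
  have "card V = card X" using triangular_finite_card[OF tX] by simp
  moreover have "card D = card V + card (L - B)"
    unfolding D_def using V fin by (intro card_Un_disjoint) (auto intro: finite_subset)
  ultimately have cD: "card D = card X + card (L - B)" by simp
  have cU: "card (verts G - B) = card (K - B) + card (L - B)"
  proof -
    have "verts G - B = (K - B) \<union> (L - B)" using verts by auto
    moreover have "(K - B) \<inter> (L - B) = {}" using disjoint by auto
    ultimately show ?thesis using fin by (simp add: card_Un_disjoint)
  qed
  have main: "(zf_step G)\<^sup>*\<^sup>* (verts G - D) (verts G)"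
  proof -
    have "(zf_step G)\<^sup>*\<^sup>* (verts G - D) ((verts G - D) \<union> V)"
    proof (rule triangular_forces_right[OF tX])
      show "X \<subseteq> verts G - D" using XK DL disjoint verts by auto
      show "V \<subseteq> verts G - (verts G - D)" using V verts unfolding D_def by auto
      show "w \<in> V" if "x \<in> X" "w \<in> verts G - (verts G - D)" "x \<rightarrow>\<^bsub>G\<^esub> w" for x w
        using that XK sep[of x w] unfolding D_def by auto
    qed
    also have "(verts G - D) \<union> V = verts G - (L - B)"
      using V verts unfolding D_def by auto
    also have "(zf_step G)\<^sup>*\<^sup>* (verts G - (L - B)) ((verts G - (L - B)) \<union> Y)"
    proof (rule triangular_forces_left[OF tY])
      show "W \<subseteq> verts G - (L - B)" "Y \<subseteq> verts G - (verts G - (L - B))"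
        using W YL verts by auto
      show "w \<in> Y" if "v \<in> W" "w \<in> verts G - (verts G - (L - B))" "v \<rightarrow>\<^bsub>G\<^esub> w" for v w
      proof -
        have w: "w \<in> L - B" and v: "v \<in> K" "w \<rightarrow>\<^bsub>G\<^esub> v" using that W adj_sym[of v w] by auto
        \<comment> \<open>The exceptional vertex has no neighbours in \<open>K\<close>, so no source
          in \<open>W\<close> sees it.\<close>
        from Y show ?thesis
        proof (elim disjE exE conjE)
          fix y
          assume "insert y Y = L - B" "\<forall>k\<in>K. \<not> y \<rightarrow>\<^bsub>G\<^esub> k"
          moreover from this v have "w \<noteq> y" by blast
          ultimately show ?thesis using w by blast
        qed (use w in blast)
      qed
    qed
    also have "(zf_step G)\<^sup>*\<^sup>* ((verts G - (L - B)) \<union> Y) (verts G)"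
      using Y
    proof (elim disjE exE conjE)
      assume "Y = L - B"
      then have "(verts G - (L - B)) \<union> Y = verts G" using verts by auto
      then show ?thesis by simp
    next
      fix y r
      assume y: "y \<notin> Y" "insert y Y = L - B" "\<forall>k\<in>K. \<not> y \<rightarrow>\<^bsub>G\<^esub> k" "r \<in> L" "r \<noteq> y"
      have eq: "(verts G - (L - B)) \<union> Y = verts G - {y}" and yv: "y \<in> L" "y \<in> verts G"
        using y verts by auto
      have "zf_step G (verts G - {y}) (insert y (verts G - {y}))"
        using y yv verts L_adj[OF y(4) yv(1) y(5)] by (intro zf_step_insert[of r]) auto
      moreover have "insert y (verts G - {y}) = verts G" using yv by auto
      ultimately show ?thesis using eq by auto
    qed
    finally show ?thesis .
  qed
  \<comment> \<open>Sizes are compared through the unfilled sets.\<close>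
  have "\<exists>D'. D' \<subseteq> verts G \<and> card D' = card (verts G - B) \<and> (zf_step G)\<^sup>*\<^sup>* (verts G - D') (verts G)"
    using X
  proof (elim disjE exE conjE)
    assume "X = K - B"
    then show ?thesis using main cD cU DL verts by auto
  next
    \<comment> \<open>Here \<open>D\<close> is one vertex too small, since \<open>X\<close> omits
      \<open>x\<close>. Leaving \<open>q\<close> unfilled as well corrects this: \<open>x\<close> is
      filled and sees only \<open>K\<close>, where \<open>q\<close> alone is unfilled, so it forces
      \<open>q\<close> at once.\<close>
    fix x q
    assume x: "x \<notin> X" "insert x X = K - B" "\<forall>l\<in>L. \<not> x \<rightarrow>\<^bsub>G\<^esub> l" "q \<in> K" "q \<noteq> x"
    have xK: "x \<in> K" using x(2) by auto
    have qD: "q \<notin> D" using x(4) DL disjoint by auto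
    have xD: "x \<notin> D" using xK DL disjoint by auto
    have "finite X" using triangular_finite_card[OF tX] by simp
    then have "card (K - B) = Suc (card X)" using x(1) unfolding x(2)[symmetric] by simp
    moreover have "finite D" using DL fin by (auto intro: finite_subset)
    ultimately have "card (insert q D) = card (verts G - B)" using qD cD cU by simp
    moreover have "zf_step G (verts G - insert q D) (insert q (verts G - insert q D))"
      using x xK xD qD DL verts K_adj[OF xK x(4)] by (intro zf_step_insert[of x]) auto
    moreover have "insert q (verts G - insert q D) = verts G - D"
      using x(4) verts qD by auto
    ultimately have "(zf_step G)\<^sup>*\<^sup>* (verts G - insert q D) (verts G)"
      using main by (metis converse_rtranclp_into_rtranclp)
    then show ?thesis
      using \<open>card (insert q D) = _\<close> DL x(4) verts by (intro exI[of _ "insert q D"]) auto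
  qed
  then obtain D' where D': "D' \<subseteq> verts G" "card D' = card (verts G - B)"
    "(zf_step G)\<^sup>*\<^sup>* (verts G - D') (verts G)" by blast
  have "card (verts G - D') = card B"
    using D' B fin card_mono[OF finite_verts B]
    by (simp add: card_Diff_subset finite_subset[OF D'(1) finite_verts])
  then show ?thesis using D' unfolding zero_forcing_set_def by (intro exI[of _ "verts G - D'"]) auto
qed

lemma psd_forcing_set_imp_zero_forcing_set:
  assumes "psd_forcing_set G B"
  shows "\<exists>B'. zero_forcing_set G B' \<and> card B' = card B"
proof (cases "\<exists>k\<in>K - B. \<exists>l\<in>L - B. k \<rightarrow>\<^bsub>G\<^esub> l")
  case True
  then show ?thesis
    using assms psd_steps_unfilled_edge unfolding psd_forcing_set_def zero_forcing_set_def by blast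
next
  case False
  interpret S: two_cliques G L K by (rule swap)
  have B: "B \<subseteq> verts G" "(psd_step G)\<^sup>*\<^sup>* B (verts G)"
    using assms unfolding psd_forcing_set_def by auto
  have sep: "\<not> k \<rightarrow>\<^bsub>G\<^esub> l" "\<not> l \<rightarrow>\<^bsub>G\<^esub> k" if "k \<in> K - B" "l \<in> L - B" for k l
    using False that adj_sym[of l k] by blast+
  obtain X V where "almost_triangular B X V"
    using psd_steps_almost_triangular[OF B(2)] sep(1) by blast
  moreover obtain Y W where "S.almost_triangular B Y W"
    using S.psd_steps_almost_triangular[OF B(2)] sep(2) by blast
  ultimately show ?thesis using separated_zero_forcing_set[OF B(1)] sep(1) by blast
qed

end

theorem theorem4p15:
  fixes G :: "('a, 'b) pre_digraph"
  assumes "graph G"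
    and "cobipartite G"
  shows "psd_forcing_number G = zero_forcing_number G"
proof -
  interpret graph G by fact
  obtain K L where "K \<union> L = verts G" "K \<inter> L = {}" "clique G K" "clique G L"
    using assms(2) unfolding cobipartite_def by blast
  then interpret two_cliques G K L by unfold_locales
  \<comment> \<open>Not only the minima agree: both kinds of forcing sets attain exactly the same
    sizes.\<close>
  have "(\<exists>B. psd_forcing_set G B \<and> card B = k) \<longleftrightarrow> (\<exists>B. zero_forcing_set G B \<and> card B = k)" for k
    using zero_forcing_set_imp_psd_forcing_set psd_forcing_set_imp_zero_forcing_set by blast
  then show ?thesis unfolding psd_forcing_number_def zero_forcing_number_def by simp
qed

end
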